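(* Let (S) denote the Hamiltonian system in $(x,y,z,w)$ (with $\dot x=\partial_yH$, $\dot y=-\partial_xH$, $\dot z=\partial_wH$, $\dot w=-\partial_zH$) with Hamiltonian $$H=H_{VI}(x,y,t;\alpha_0,\alpha_1,\alpha_2,\alpha_3,\alpha_4)+H_{VI}(z,w,t;\beta_0,\beta_1,\beta_2,\beta_3,\beta_4)+\frac{2(x-t)yz\{(z-1)w+\beta_2\}}{t(t-1)}.$$ Make the change of parameters and variables $$\tfrac{\alpha_0-\alpha_1}{2}=A_0,\quad \alpha_1=A_1,\quad \alpha_2=A_2,\quad \alpha_4-\beta_4=A_3,\quad \beta_2=A_4,\quad \beta_3=A_5,\quad \beta_4=A_6,$$ $$X=\frac1x,\quad Y=-(xy+\alpha_2)x,\quad Z=z,\quad W=w$$ from $\alpha_0,\alpha_1,\alpha_2,\alpha_4,\beta_2,\beta_3,\beta_4,x,y,z,w$ to $A_0,\dots,A_6,X,Y,Z,W$. Then (S) can also be written in the new variables $X,Y,Z,W$ and parameters $A_0,\dots,A_6$ as a Hamiltonian system, and this new system is the Hamiltonian system in $(X,Y,Z,W)$ with Hamiltonian \begin{align*} &\tilde H_{VI}(X,Y,t;2A_0+A_1,A_1,A_2,A_3+2A_4+A_5,A_3+A_6)\\ &+H_{VI}(Z,W,t;2A_0+A_1+2A_2+A_3,A_1+A_3,A_4,A_5,A_6)+\frac{2XZ\{(tX-1)Y+tA_2\}\{(Z-1)W+A_4\}}{t(t-1)}. \end{align*}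
   Context: For parameters with $\delta_0+\delta_1+2\delta_2+\delta_3+\delta_4=1$, $$H_{VI}(q,p,t;\delta_0,\dots,\delta_4)=\tfrac{1}{t(t-1)}\big[p^2(q-t)(q-1)q-\{(\delta_0-1)(q-1)q+\delta_3(q-t)q+\delta_4(q-t)(q-1)\}p+\delta_2(\delta_1+\delta_2)q\big],$$ $$\tilde H_{VI}(Q,P,t;\delta_0,\dots,\delta_4)=\tfrac{1}{t(t-1)}\big[P^2(tQ-1)(Q-1)Q-\{(\delta_0-1)t(Q-1)Q+\delta_1(Q-1)(tQ-1)+\delta_3Q(tQ-1)\}P+\delta_2(\delta_2+\delta_4)tQ\big].$$ The free parameters of (S) are complex numbers $\alpha_0,\alpha_1,\alpha_2,\alpha_4,\beta_2,\beta_3,\beta_4$ with $\alpha_0+\alpha_1+2\alpha_2+2(\alpha_4-\beta_4)+2\beta_2+\beta_3+\beta_4=1$ (equivalently $2A_0+2A_1+2A_2+2A_3+2A_4+A_5+A_6=1$); the other parameters are determined by $\alpha_3=\alpha_4-\beta_4+2\beta_2+\beta_3$, $\beta_0=\alpha_0+\alpha_4-\beta_4$, $\beta_1=\alpha_1+2\alpha_2+\alpha_4-\beta_4$. *)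

theory Defs
  imports "HOL-Analysis.Analysis"
begin

text \<open>The \<open>H\<^sub>V\<^sub>I\<close> of the sixth Painleve equation. The parameters are meant to satisfy
  \<open>\<delta>0 + \<delta>1 + 2 * \<delta>2 + \<delta>3 + \<delta>4 = 1\<close>, and \<open>t\<close> to be different from \<open>0\<close> and \<open>1\<close>.\<close>

definition HVI ::
  "complex \<Rightarrow> complex \<Rightarrow> complex \<Rightarrow> complex \<Rightarrow> complex \<Rightarrow> complex \<Rightarrow> complex \<Rightarrow> complex \<Rightarrow> complex"
  where
  "HVI q p t \<delta>0 \<delta>1 \<delta>2 \<delta>3 \<delta>4 =
     1 / (t * (t - 1)) *
       (p\<^sup>2 * (q - t) * (q - 1) * q
        - ((\<delta>0 - 1) * (q - 1) * q + \<delta>3 * (q - t) * q + \<delta>4 * (q - t) * (q - 1)) * p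
        + \<delta>2 * (\<delta>1 + \<delta>2) * q)"

definition HVI_tilde ::
  "complex \<Rightarrow> complex \<Rightarrow> complex \<Rightarrow> complex \<Rightarrow> complex \<Rightarrow> complex \<Rightarrow> complex \<Rightarrow> complex \<Rightarrow> complex"
  where
  "HVI_tilde Q P t \<delta>0 \<delta>1 \<delta>2 \<delta>3 \<delta>4 =
     1 / (t * (t - 1)) *
       (P\<^sup>2 * (t * Q - 1) * (Q - 1) * Q
        - ((\<delta>0 - 1) * t * (Q - 1) * Q + \<delta>1 * (Q - 1) * (t * Q - 1) + \<delta>3 * Q * (t * Q - 1)) * P
        + \<delta>2 * (\<delta>2 + \<delta>4) * t * Q)"

text \<open>A Hamiltonian is a function \<open>H x y z w t\<close> with canonical pairs \<open>(x, y)\<close> and \<open>(z, w)\<close>;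
  the dot is the complex derivative in \<open>t\<close>. The set \<open>U\<close> of times need not be open: the
  derivatives are two-sided ones, \<open>at t\<close>, for each \<open>t \<in> U\<close>, so singletons \<open>U\<close> give the
  equations at a single time. The partial derivatives are written with \<open>deriv\<close>, which is
  adequate because the Hamiltonians below are polynomial in each of \<open>x, y, z, w\<close>.\<close>

definition solves_hamiltonian_system ::
  "(complex \<Rightarrow> complex \<Rightarrow> complex \<Rightarrow> complex \<Rightarrow> complex \<Rightarrow> complex) \<Rightarrow> complex set \<Rightarrow>
   (complex \<Rightarrow> complex) \<Rightarrow> (complex \<Rightarrow> complex) \<Rightarrow> (complex \<Rightarrow> complex) \<Rightarrow> (complex \<Rightarrow> complex) \<Rightarrow> bool"
  where
  "solves_hamiltonian_system H U x y z w \<longleftrightarrow>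
     (\<forall>t\<in>U.
        (x has_field_derivative deriv (\<lambda>\<eta>. H (x t) \<eta> (z t) (w t) t) (y t)) (at t) \<and>
        (y has_field_derivative - deriv (\<lambda>\<xi>. H \<xi> (y t) (z t) (w t) t) (x t)) (at t) \<and>
        (z has_field_derivative deriv (\<lambda>\<omega>. H (x t) (y t) (z t) \<omega> t) (w t)) (at t) \<and>
        (w has_field_derivative - deriv (\<lambda>\<zeta>. H (x t) (y t) \<zeta> (w t) t) (z t)) (at t))"

definition hamiltonian_S ::
  "complex \<Rightarrow> complex \<Rightarrow> complex \<Rightarrow> complex \<Rightarrow> complex \<Rightarrow>
   complex \<Rightarrow> complex \<Rightarrow> complex \<Rightarrow> complex \<Rightarrow> complex \<Rightarrow>
   complex \<Rightarrow> complex \<Rightarrow> complex \<Rightarrow> complex \<Rightarrow> complex \<Rightarrow> complex"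
  where
  "hamiltonian_S \<alpha>0 \<alpha>1 \<alpha>2 \<alpha>3 \<alpha>4 \<beta>0 \<beta>1 \<beta>2 \<beta>3 \<beta>4 x y z w t =
     HVI x y t \<alpha>0 \<alpha>1 \<alpha>2 \<alpha>3 \<alpha>4 + HVI z w t \<beta>0 \<beta>1 \<beta>2 \<beta>3 \<beta>4
     + 2 * (x - t) * y * z * ((z - 1) * w + \<beta>2) / (t * (t - 1))"

definition hamiltonian_S_tilde ::
  "complex \<Rightarrow> complex \<Rightarrow> complex \<Rightarrow> complex \<Rightarrow> complex \<Rightarrow> complex \<Rightarrow> complex \<Rightarrow>
   complex \<Rightarrow> complex \<Rightarrow> complex \<Rightarrow> complex \<Rightarrow> complex \<Rightarrow> complex"
  where
  "hamiltonian_S_tilde A0 A1 A2 A3 A4 A5 A6 X Y Z W t =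
     HVI_tilde X Y t (2 * A0 + A1) A1 A2 (A3 + 2 * A4 + A5) (A3 + A6)
     + HVI Z W t (2 * A0 + A1 + 2 * A2 + A3) (A1 + A3) A4 A5 A6
     + 2 * X * Z * ((t * X - 1) * Y + t * A2) * ((Z - 1) * W + A4) / (t * (t - 1))"

text \<open>The change of variables is defined where \<open>x \<noteq> 0\<close>.\<close>

definition change_vars ::
  "complex \<Rightarrow> complex \<times> complex \<times> complex \<times> complex \<Rightarrow> complex \<times> complex \<times> complex \<times> complex"
  where
  "change_vars \<alpha>2 = (\<lambda>(x, y, z, w). (1 / x, - (x * y + \<alpha>2) * x, z, w))"

end

theory Submission
  imports Defs
begin

text \<open>The change of variables does not depend on \<open>t\<close>, is an involution where \<open>x \<noteq> 0\<close>, and is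
  symplectic: \<open>dX \<and> dY = dx \<and> dy\<close>. Under it the two Hamiltonians agree up to a summand that
  depends on \<open>t\<close> only, so the two systems have the same solutions.\<close>

section \<open>The change of variables, on points and along curves\<close>

lemma bij_betw_change_vars:
  "bij_betw (change_vars a) {(x, y, z, w). x \<noteq> 0} {(X, Y, Z, W). X \<noteq> 0}"
  \<comment> \<open>The map is its own inverse because \<open>X * Y + a = - x * y\<close>, hence
    \<open>- (X * Y + a) * X = y\<close>.\<close>
  by (rule bij_betw_byWitness[where f' = "change_vars a"])
     (auto simp: change_vars_def field_simps)

text \<open>Both functions have exactly the same candidates \<open>D\<close> for a derivative at
  \<open>s\<close>, so the choice made by \<open>deriv\<close> is the same whether or not
  \<open>f\<close> is differentiable. This removes the summand depending on \<open>t\<close> alone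
  from the \<open>z\<close> and \<open>w\<close> equations.\<close>

lemma deriv_add_const: "deriv (\<lambda>\<xi>. f \<xi> + c) s = deriv f s"
proof -
  have "((\<lambda>\<xi>. f \<xi> + c) has_field_derivative D) (at s) \<longleftrightarrow> (f has_field_derivative D) (at s)" for D
    using DERIV_add[of "\<lambda>\<xi>. f \<xi> + c" D s UNIV "\<lambda>_. - c" 0]
      DERIV_add[of f D s UNIV "\<lambda>_. c" 0]
    by auto
  then show ?thesis
    by (simp add: deriv_def)
qed

lemma has_field_derivative_change_vars:
  fixes x y :: "complex \<Rightarrow> complex"
  assumes "(x has_field_derivative x') (at t)" and "(y has_field_derivative y') (at t)"
    and "x t \<noteq> 0"
  shows "((\<lambda>s. 1 / x s) has_field_derivative - x' / (x t)\<^sup>2) (at t)"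
    and "((\<lambda>s. - (x s * y s + a) * x s) has_field_derivative
           - (2 * x t * y t + a) * x' - (x t)\<^sup>2 * y') (at t)"
  using assms by (auto intro!: derivative_eq_intros simp: field_simps power2_eq_square)

text \<open>The hypotheses on \<open>Hy\<close> and \<open>Hx\<close> are the chain rule with dX/dx
  = \<open>- 1 / x^2\<close>, dY/dx = \<open>- (2 * x * y + a)\<close> and dY/dy =
  \<open>- x^2\<close>. One direction differentiates \<open>X\<close> and \<open>Y\<close>; the
  other is the same computation with the roles exchanged, the map being an involution.\<close>

lemma has_field_derivative_change_vars_iff:
  fixes x y X Y :: "complex \<Rightarrow> complex"
  assumes X: "\<And>s. X s = 1 / x s" and Y: "\<And>s. Y s = - (x s * y s + a) * x s"
    and x0: "x t \<noteq> 0"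
    and Hy: "Hy = - (x t)\<^sup>2 * KY" and Hx: "Hx = - KX / (x t)\<^sup>2 - (2 * x t * y t + a) * KY"
  shows "(x has_field_derivative Hy) (at t) \<and> (y has_field_derivative - Hx) (at t) \<longleftrightarrow>
         (X has_field_derivative KY) (at t) \<and> (Y has_field_derivative - KX) (at t)"
    (is "?L \<longleftrightarrow> ?R")
proof
  assume ?L
  then have L: "(x has_field_derivative Hy) (at t)" "(y has_field_derivative - Hx) (at t)"
    by auto
  have 1: "- Hy / (x t)\<^sup>2 = KY"
    using x0 by (simp add: Hy)
  have 2: "- (2 * x t * y t + a) * Hy - (x t)\<^sup>2 * (- Hx) = - KX"
    using x0 by (simp add: Hx Hy field_simps)
  have XY: "X = (\<lambda>s. 1 / x s)" "Y = (\<lambda>s. - (x s * y s + a) * x s)"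
    using X Y by auto
  show ?R
    using has_field_derivative_change_vars(1)[OF L x0]
      has_field_derivative_change_vars(2)[OF L x0, of a] unfolding 1 2 XY by blast
next
  assume ?R
  then have R: "(X has_field_derivative KY) (at t)" "(Y has_field_derivative - KX) (at t)"
    by auto
  have X0: "X t \<noteq> 0"
    using x0 X by simp
  have inv: "y s = - (X s * Y s + a) * X s" if "X s \<noteq> 0" for s
    using that by (auto simp: X Y field_simps)
  \<comment> \<open>\<open>x\<close> is nonzero only at \<open>t\<close> by assumption, and where
    \<open>x s = 0\<close> the value \<open>y s\<close> cannot be recovered. Continuity of
    \<open>X\<close> at \<open>t\<close> makes the inversion valid near \<open>t\<close>, which
    suffices for a derivative at \<open>t\<close>.\<close>
  have "\<forall>\<^sub>F s in nhds t. X s \<noteq> 0"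
    using tendsto_imp_eventually_ne[OF DERIV_isCont[OF R(1), unfolded isCont_def] X0] X0
    by (auto simp: eventually_at_filter elim: eventually_mono)
  then have ev: "\<forall>\<^sub>F s in nhds t. - (X s * Y s + a) * X s = y s"
    by eventually_elim (simp add: inv)
  have 1: "- KY / (X t)\<^sup>2 = Hy"
    using x0 by (simp add: X Hy field_simps)
  have 2: "- (2 * X t * Y t + a) * KY - (X t)\<^sup>2 * (- KX) = - Hx"
    using x0 by (simp add: X Y Hx field_simps power2_eq_square)
  \<comment> \<open>This holds at every \<open>s\<close>, zeros of \<open>x\<close> included, since
    \<open>1 / 0 = 0\<close>.\<close>
  have x: "x = (\<lambda>s. 1 / X s)"
    by (simp add: X fun_eq_iff)
  note D = has_field_derivative_change_vars(1)[OF R X0, unfolded 1]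
    has_field_derivative_change_vars(2)[OF R X0, of a, unfolded 2]
  have "(y has_field_derivative - Hx) (at t)"
    using D(2) DERIV_cong_ev[OF refl ev refl] by blast
  then show ?L
    using D(1) unfolding x by blast
qed

section \<open>Explicit partial derivatives in the first canonical pair\<close>

lemma deriv_hamiltonian_S:
  fixes t :: complex
  defines "k \<equiv> 1 / (t * (t - 1))"
  shows "deriv (\<lambda>\<xi>. hamiltonian_S \<alpha>0 \<alpha>1 \<alpha>2 \<alpha>3 \<alpha>4 \<beta>0 \<beta>1 \<beta>2 \<beta>3 \<beta>4 \<xi> y z w t) x =
     k * (y\<^sup>2 * ((x - 1) * x + (x - t) * x + (x - t) * (x - 1))
          - ((\<alpha>0 - 1) * (2 * x - 1) + \<alpha>3 * (2 * x - t) + \<alpha>4 * (2 * x - t - 1)) * y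
          + \<alpha>2 * (\<alpha>1 + \<alpha>2) + 2 * y * z * ((z - 1) * w + \<beta>2))"
    and "deriv (\<lambda>\<eta>. hamiltonian_S \<alpha>0 \<alpha>1 \<alpha>2 \<alpha>3 \<alpha>4 \<beta>0 \<beta>1 \<beta>2 \<beta>3 \<beta>4 x \<eta> z w t) y =
     k * (2 * y * (x - t) * (x - 1) * x
          - ((\<alpha>0 - 1) * (x - 1) * x + \<alpha>3 * (x - t) * x + \<alpha>4 * (x - t) * (x - 1))
          + 2 * (x - t) * z * ((z - 1) * w + \<beta>2))"
proof -
  have H: "hamiltonian_S \<alpha>0 \<alpha>1 \<alpha>2 \<alpha>3 \<alpha>4 \<beta>0 \<beta>1 \<beta>2 \<beta>3 \<beta>4 \<xi> \<eta> z w t =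
      k * (\<eta>\<^sup>2 * (\<xi> - t) * (\<xi> - 1) * \<xi>
        - ((\<alpha>0 - 1) * (\<xi> - 1) * \<xi> + \<alpha>3 * (\<xi> - t) * \<xi> + \<alpha>4 * (\<xi> - t) * (\<xi> - 1)) * \<eta>
        + \<alpha>2 * (\<alpha>1 + \<alpha>2) * \<xi> + 2 * (\<xi> - t) * \<eta> * z * ((z - 1) * w + \<beta>2))
      + HVI z w t \<beta>0 \<beta>1 \<beta>2 \<beta>3 \<beta>4" for \<xi> \<eta>
    \<comment> \<open>Only the first \<open>HVI\<close> is unfolded; the one in \<open>z, w\<close>
      stays opaque and is a constant for both differentiations.\<close>
    unfolding hamiltonian_S_def HVI_def[of \<xi>] k_def
    by (simp add: distrib_left add_divide_distrib)
  show "deriv (\<lambda>\<xi>. hamiltonian_S \<alpha>0 \<alpha>1 \<alpha>2 \<alpha>3 \<alpha>4 \<beta>0 \<beta>1 \<beta>2 \<beta>3 \<beta>4 \<xi> y z w t) x =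
     k * (y\<^sup>2 * ((x - 1) * x + (x - t) * x + (x - t) * (x - 1))
          - ((\<alpha>0 - 1) * (2 * x - 1) + \<alpha>3 * (2 * x - t) + \<alpha>4 * (2 * x - t - 1)) * y
          + \<alpha>2 * (\<alpha>1 + \<alpha>2) + 2 * y * z * ((z - 1) * w + \<beta>2))"
    unfolding H by (rule DERIV_imp_deriv)
      (rule derivative_eq_intros refl | simp add: algebra_simps)+
  show "deriv (\<lambda>\<eta>. hamiltonian_S \<alpha>0 \<alpha>1 \<alpha>2 \<alpha>3 \<alpha>4 \<beta>0 \<beta>1 \<beta>2 \<beta>3 \<beta>4 x \<eta> z w t) y =
     k * (2 * y * (x - t) * (x - 1) * x
          - ((\<alpha>0 - 1) * (x - 1) * x + \<alpha>3 * (x - t) * x + \<alpha>4 * (x - t) * (x - 1))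
          + 2 * (x - t) * z * ((z - 1) * w + \<beta>2))"
    unfolding H by (rule DERIV_imp_deriv)
      (rule derivative_eq_intros refl | simp add: algebra_simps)+
qed

lemma deriv_hamiltonian_S_tilde:
  fixes t :: complex
  defines "k \<equiv> 1 / (t * (t - 1))"
  shows "deriv (\<lambda>\<xi>. hamiltonian_S_tilde A0 A1 A2 A3 A4 A5 A6 \<xi> Y Z W t) X =
     k * (Y\<^sup>2 * (t * (X - 1) * X + (t * X - 1) * X + (t * X - 1) * (X - 1))
          - ((2 * A0 + A1 - 1) * t * (2 * X - 1) + A1 * (2 * t * X - t - 1)
             + (A3 + 2 * A4 + A5) * (2 * t * X - 1)) * Y
          + A2 * (A2 + A3 + A6) * t
          + 2 * Z * ((2 * t * X - 1) * Y + t * A2) * ((Z - 1) * W + A4))"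
    and "deriv (\<lambda>\<eta>. hamiltonian_S_tilde A0 A1 A2 A3 A4 A5 A6 X \<eta> Z W t) Y =
     k * (2 * Y * (t * X - 1) * (X - 1) * X
          - ((2 * A0 + A1 - 1) * t * (X - 1) * X + A1 * (X - 1) * (t * X - 1)
             + (A3 + 2 * A4 + A5) * X * (t * X - 1))
          + 2 * X * Z * (t * X - 1) * ((Z - 1) * W + A4))"
proof -
  have H: "hamiltonian_S_tilde A0 A1 A2 A3 A4 A5 A6 \<xi> \<eta> Z W t =
      k * (\<eta>\<^sup>2 * (t * \<xi> - 1) * (\<xi> - 1) * \<xi>
        - ((2 * A0 + A1 - 1) * t * (\<xi> - 1) * \<xi> + A1 * (\<xi> - 1) * (t * \<xi> - 1)
           + (A3 + 2 * A4 + A5) * \<xi> * (t * \<xi> - 1)) * \<eta>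
        + A2 * (A2 + (A3 + A6)) * t * \<xi>
        + 2 * \<xi> * Z * ((t * \<xi> - 1) * \<eta> + t * A2) * ((Z - 1) * W + A4))
      + HVI Z W t (2 * A0 + A1 + 2 * A2 + A3) (A1 + A3) A4 A5 A6" for \<xi> \<eta>
    unfolding hamiltonian_S_tilde_def HVI_tilde_def k_def
    by (simp add: distrib_left add_divide_distrib)
  show "deriv (\<lambda>\<xi>. hamiltonian_S_tilde A0 A1 A2 A3 A4 A5 A6 \<xi> Y Z W t) X =
     k * (Y\<^sup>2 * (t * (X - 1) * X + (t * X - 1) * X + (t * X - 1) * (X - 1))
          - ((2 * A0 + A1 - 1) * t * (2 * X - 1) + A1 * (2 * t * X - t - 1)
             + (A3 + 2 * A4 + A5) * (2 * t * X - 1)) * Y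
          + A2 * (A2 + A3 + A6) * t
          + 2 * Z * ((2 * t * X - 1) * Y + t * A2) * ((Z - 1) * W + A4))"
    unfolding H by (rule DERIV_imp_deriv)
      (rule derivative_eq_intros refl | simp add: algebra_simps)+
  show "deriv (\<lambda>\<eta>. hamiltonian_S_tilde A0 A1 A2 A3 A4 A5 A6 X \<eta> Z W t) Y =
     k * (2 * Y * (t * X - 1) * (X - 1) * X
          - ((2 * A0 + A1 - 1) * t * (X - 1) * X + A1 * (X - 1) * (t * X - 1)
             + (A3 + 2 * A4 + A5) * X * (t * X - 1))
          + 2 * X * Z * (t * X - 1) * ((Z - 1) * W + A4))"
    unfolding H by (rule DERIV_imp_deriv)
      (rule derivative_eq_intros refl | simp add: algebra_simps)+
qed

section \<open>Comparison of the two systems under the change of parameters\<close>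

context
  fixes \<alpha>0 \<alpha>1 \<alpha>2 \<alpha>3 \<alpha>4 \<beta>0 \<beta>1 \<beta>2 \<beta>3 \<beta>4 A0 A1 A2 A3 A4 A5 A6 :: complex
  assumes params: "\<alpha>0 = 2 * A0 + A1" "\<alpha>1 = A1" "\<alpha>2 = A2" "\<alpha>3 = A3 + 2 * A4 + A5"
      "\<alpha>4 = A3 + A6" "\<beta>0 = 2 * A0 + A1 + A3" "\<beta>1 = A1 + 2 * A2 + A3"
      "\<beta>2 = A4" "\<beta>3 = A5" "\<beta>4 = A6"
    and sum_A: "2 * A0 + 2 * A1 + 2 * A2 + 2 * A3 + 2 * A4 + A5 + A6 = 1"
begin

text \<open>Eliminating \<open>A6\<close> leaves independent parameters, so identities modulo the
  parameter relation become plain rational identities.\<close>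

lemma A6_eq: "A6 = 1 - 2 * A0 - 2 * A1 - 2 * A2 - 2 * A3 - 2 * A4 - A5"
  using sum_A by (simp add: algebra_simps)

private abbreviation (input) H where "H \<equiv> hamiltonian_S \<alpha>0 \<alpha>1 \<alpha>2 \<alpha>3 \<alpha>4 \<beta>0 \<beta>1 \<beta>2 \<beta>3 \<beta>4"
private abbreviation (input) K where "K \<equiv> hamiltonian_S_tilde A0 A1 A2 A3 A4 A5 A6"

text \<open>Expand in \<open>X = 1 / x\<close> and \<open>Y\<close>, up to the factor
  \<open>1 / (t * (t - 1))\<close>. The \<open>1 / X\<close> terms have coefficient \<open>A2 *
  (\<alpha>0 + \<alpha>1 + 2 * \<alpha>2 + \<alpha>3 + \<alpha>4 - 1) = 0\<close>; the terms of the
  first \<open>HVI\<close> free of \<open>X\<close> and \<open>Y\<close> form the subtracted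
  constant. The coupling leaves \<open>- 2 * A2 * z * ((z - 1) * w + A4)\<close>, which is absorbed
  by moving \<open>2 * A2\<close> from the second to the first parameter of the \<open>HVI\<close>
  in \<open>z, w\<close>.\<close>

lemma hamiltonian_S_eq_tilde:
  assumes "x \<noteq> 0"
  shows "H x y z w t = K (1 / x) (- (x * y + \<alpha>2) * x) z w t
    - A2 * (A2 * (1 + t) + (2 * A0 + A1 - 1) + (A3 + 2 * A4 + A5) * t + (A3 + A6) * (1 + t))
      / (t * (t - 1))"
proof -
  \<comment> \<open>With the prefactor kept as an atom, \<open>x\<close> is the only denominator
    left to clear.\<close>
  define k where "k = 1 / (t * (t - 1))"
  have k: "u / (t * (t - 1)) = k * u" for u
    by (simp add: k_def)
  show ?thesis
    unfolding hamiltonian_S_def hamiltonian_S_tilde_def HVI_def HVI_tilde_def params k A6_eq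
    using assms by (simp add: field_simps power2_eq_square)
qed

text \<open>The chain rule for the preceding identity. In \<open>x\<close> and \<open>y\<close> it
  is checked on the explicit derivative formulas.\<close>

lemma deriv_hamiltonian_S_eq_tilde:
  fixes x y :: complex
  assumes "x \<noteq> 0"
  defines "X \<equiv> 1 / x" and "Y \<equiv> - (x * y + \<alpha>2) * x"
  shows "deriv (\<lambda>\<eta>. H x \<eta> z w t) y = - x\<^sup>2 * deriv (\<lambda>\<eta>. K X \<eta> z w t) Y"
    and "deriv (\<lambda>\<xi>. H \<xi> y z w t) x =
      - deriv (\<lambda>\<xi>. K \<xi> Y z w t) X / x\<^sup>2 - (2 * x * y + \<alpha>2) * deriv (\<lambda>\<eta>. K X \<eta> z w t) Y"
    and "deriv (\<lambda>\<omega>. H x y z \<omega> t) w = deriv (\<lambda>\<omega>. K X Y z \<omega> t) w"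
    and "deriv (\<lambda>\<zeta>. H x y \<zeta> w t) z = deriv (\<lambda>\<zeta>. K X Y \<zeta> w t) z"
proof -
  define k where "k = 1 / (t * (t - 1))"
  show "deriv (\<lambda>\<eta>. H x \<eta> z w t) y = - x\<^sup>2 * deriv (\<lambda>\<eta>. K X \<eta> z w t) Y"
    unfolding deriv_hamiltonian_S deriv_hamiltonian_S_tilde X_def Y_def params k_def[symmetric] A6_eq
    using assms(1) by (simp add: field_simps power2_eq_square)
  show "deriv (\<lambda>\<xi>. H \<xi> y z w t) x =
      - deriv (\<lambda>\<xi>. K \<xi> Y z w t) X / x\<^sup>2 - (2 * x * y + \<alpha>2) * deriv (\<lambda>\<eta>. K X \<eta> z w t) Y"
    unfolding deriv_hamiltonian_S deriv_hamiltonian_S_tilde X_def Y_def params k_def[symmetric] A6_eq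
    using assms(1) by (simp add: field_simps power2_eq_square)
  \<comment> \<open>Here \<open>x\<close> stays fixed and nonzero, so the identity of Hamiltonians
    can be rewritten under the binder and its last summand is a constant.\<close>
  show "deriv (\<lambda>\<omega>. H x y z \<omega> t) w = deriv (\<lambda>\<omega>. K X Y z \<omega> t) w"
    and "deriv (\<lambda>\<zeta>. H x y \<zeta> w t) z = deriv (\<lambda>\<zeta>. K X Y \<zeta> w t) z"
    unfolding hamiltonian_S_eq_tilde[OF assms(1)] X_def Y_def
    by (simp_all only: diff_conv_add_uminus deriv_add_const)
qed

lemma solves_hamiltonian_S_iff_tilde:
  assumes x0: "\<And>t. t \<in> U \<Longrightarrow> x t \<noteq> 0"
    and cv: "\<And>t. (X t, Y t, Z t, W t) = change_vars \<alpha>2 (x t, y t, z t, w t)"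
  shows "solves_hamiltonian_system H U x y z w \<longleftrightarrow> solves_hamiltonian_system K U X Y Z W"
proof -
  have X: "X s = 1 / x s" and Y: "Y s = - (x s * y s + \<alpha>2) * x s" for s
    using cv[of s] by (auto simp: change_vars_def)
  have ZW: "Z = z" "W = w"
    using cv by (auto simp: change_vars_def)
  show ?thesis
    unfolding solves_hamiltonian_system_def ZW
  proof (rule ball_cong[OF refl])
    fix t assume "t \<in> U"
    note D = deriv_hamiltonian_S_eq_tilde[OF x0[OF this], where y = "y t" and z = "z t" and w = "w t" and t = t,
        folded X Y]
    \<comment> \<open>The equations for the first pair are equivalent only jointly; those for
      \<open>z\<close> and \<open>w\<close> have equal right-hand sides by
      \<open>D(3,4)\<close>.\<close>
    from has_field_derivative_change_vars_iff[where x = x and y = y and a = \<alpha>2 and t = t,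
        OF X Y x0[OF \<open>t \<in> U\<close>] D(1,2)]
    show "((x has_field_derivative deriv (\<lambda>\<eta>. H (x t) \<eta> (z t) (w t) t) (y t)) (at t) \<and>
        (y has_field_derivative - deriv (\<lambda>\<xi>. H \<xi> (y t) (z t) (w t) t) (x t)) (at t) \<and>
        (z has_field_derivative deriv (\<lambda>\<omega>. H (x t) (y t) (z t) \<omega> t) (w t)) (at t) \<and>
        (w has_field_derivative - deriv (\<lambda>\<zeta>. H (x t) (y t) \<zeta> (w t) t) (z t)) (at t)) \<longleftrightarrow>
       ((X has_field_derivative deriv (\<lambda>\<eta>. K (X t) \<eta> (z t) (w t) t) (Y t)) (at t) \<and>
        (Y has_field_derivative - deriv (\<lambda>\<xi>. K \<xi> (Y t) (z t) (w t) t) (X t)) (at t) \<and>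
        (z has_field_derivative deriv (\<lambda>\<omega>. K (X t) (Y t) (z t) \<omega> t) (w t)) (at t) \<and>
        (w has_field_derivative - deriv (\<lambda>\<zeta>. K (X t) (Y t) \<zeta> (w t) t) (z t)) (at t))"
      unfolding D(3,4) by blast
  qed
qed

end

theorem theorem3p2:
  fixes \<alpha>0 \<alpha>1 \<alpha>2 \<alpha>3 \<alpha>4 \<beta>0 \<beta>1 \<beta>2 \<beta>3 \<beta>4 A0 A1 A2 A3 A4 A5 A6 :: complex
  assumes "\<alpha>0 + \<alpha>1 + 2 * \<alpha>2 + 2 * (\<alpha>4 - \<beta>4) + 2 * \<beta>2 + \<beta>3 + \<beta>4 = 1"
    and "\<alpha>3 = \<alpha>4 - \<beta>4 + 2 * \<beta>2 + \<beta>3"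
    and "\<beta>0 = \<alpha>0 + \<alpha>4 - \<beta>4"
    and "\<beta>1 = \<alpha>1 + 2 * \<alpha>2 + \<alpha>4 - \<beta>4"
    and "(\<alpha>0 - \<alpha>1) / 2 = A0" and "\<alpha>1 = A1" and "\<alpha>2 = A2" and "\<alpha>4 - \<beta>4 = A3"
    and "\<beta>2 = A4" and "\<beta>3 = A5" and "\<beta>4 = A6"
  shows "bij_betw (change_vars \<alpha>2) {(x, y, z, w). x \<noteq> 0} {(X, Y, Z, W). X \<noteq> 0} \<and>
    (\<forall>(U :: complex set) (x :: complex \<Rightarrow> complex) y z w X Y Z W.
       0 \<notin> U \<and> 1 \<notin> U \<and> (\<forall>t\<in>U. x t \<noteq> 0) \<and>
       (\<forall>t. (X t, Y t, Z t, W t) = change_vars \<alpha>2 (x t, y t, z t, w t)) \<longrightarrow>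
       (solves_hamiltonian_system (hamiltonian_S \<alpha>0 \<alpha>1 \<alpha>2 \<alpha>3 \<alpha>4 \<beta>0 \<beta>1 \<beta>2 \<beta>3 \<beta>4) U x y z w \<longleftrightarrow>
        solves_hamiltonian_system (hamiltonian_S_tilde A0 A1 A2 A3 A4 A5 A6) U X Y Z W))"
proof -
  \<comment> \<open>The linear parameter change is inverted, so that everything is expressed through
    \<open>A0\<close>, ..., \<open>A6\<close>.\<close>
  have \<alpha>4: "\<alpha>4 = A3 + A6" and \<alpha>0: "\<alpha>0 = 2 * A0 + A1"
    using assms by (auto simp: field_simps)
  have "2 * A0 + 2 * A1 + 2 * A2 + 2 * A3 + 2 * A4 + A5 + A6 = 1"
    using assms(1) unfolding \<alpha>0 \<alpha>4 assms(6,7,9-11) by (simp add: algebra_simps)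
  moreover have "\<beta>0 = 2 * A0 + A1 + A3" "\<beta>1 = A1 + 2 * A2 + A3" "\<alpha>3 = A3 + 2 * A4 + A5"
    using assms \<alpha>0 by (auto simp: algebra_simps)
  ultimately show ?thesis
    using solves_hamiltonian_S_iff_tilde[OF \<alpha>0 assms(6,7) _ \<alpha>4 _ _ assms(9-11)]
      bij_betw_change_vars by blast
qed

end
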